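(* For any topological flow $(X,T)$, the flows $(E(X),T)$ and $(E(E(X)),T)$ are isomorphic.
   Context: A (topological) flow $(X,T)$ consists of a compact Hausdorff space $X$, a topological group $T$, and a continuous map $\pi:T\times X\to X$, written $\pi(t,x)=tx$, with $(st)x=s(tx)$ and such that each $\pi^t:X\to X$, $\pi^t(x)=tx$, is a homeomorphism (so the identity of $T$ acts as the identity map). Standing assumption: the space $X$ of the given flow has no isolated points (this is not required of $E(X)$ or $E(E(X))$). The enveloping semigroup is $E(X)=\overline{\{\pi^t: t\in T\}}\subseteq X^X$, the closure being taken in the product topology; $T$ acts on the compact Hausdorff space $E(X)$ by $\hat{\pi}^t(p)=\pi^t\circ p$. Likewise $E(E(X))=\overline{\{\hat{\pi}^t:t\in T\}}\subseteq E(X)^{E(X)}$ (product topology) is the enveloping semigroup of $(E(X),T)$, on which $T$ acts by $t\cdot\hat g=\hat{\pi}^t\circ\hat g$. Two compact Hausdorff spaces $Y,Z$ with continuous actions of $T$ are isomorphic as flows if there is a continuous bijection $\phi:Y\to Z$ with $\phi(ty)=t\phi(y)$ for all $t\in T$, $y\in Y$. *)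

theory Defs
  imports "HOL-Analysis.Analysis" "HOL-Algebra.Group"
begin

locale topological_group = group T for T (structure) +
  fixes \<tau> :: "'t topology"
  assumes topspace_eq: "topspace \<tau> = carrier T"
    and continuous_mult: "continuous_map (prod_topology \<tau> \<tau>) \<tau> (\<lambda>(s, t). s \<otimes> t)"
    and continuous_inv: "continuous_map \<tau> \<tau> (\<lambda>t. inv t)"

text \<open>The space \<open>X\<close> of a flow may have isolated points here, since enveloping semigroups
  may have them.\<close>

locale flow = topological_group T \<tau> for T :: "('t, 'm) monoid_scheme" (structure) and \<tau> +
  fixes X :: "'x topology" and \<pi> :: "'t \<Rightarrow> 'x \<Rightarrow> 'x"
  assumes compact: "compact_space X"
    and Hausdorff: "Hausdorff_space X"
    and continuous_action: "continuous_map (prod_topology \<tau> X) X (\<lambda>(t, x). \<pi> t x)"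
    and action_mult: "\<lbrakk>s \<in> carrier T; t \<in> carrier T; x \<in> topspace X\<rbrakk>
      \<Longrightarrow> \<pi> (s \<otimes> t) x = \<pi> s (\<pi> t x)"
    and homeomorphic_action: "t \<in> carrier T \<Longrightarrow> homeomorphic_map X X (\<pi> t)"

text \<open>The points of \<open>product_topology (\<lambda>_. X) (topspace X)\<close> are the self-maps of \<open>topspace X\<close>
  represented as extensional functions (\<open>undefined\<close> off \<open>topspace X\<close>). Hence \<open>\<pi> t\<close> is restricted
  to \<open>topspace X\<close>, and composition is the extensional \<^const>\<open>compose\<close>.\<close>

definition enveloping_semigroup ::
  "('t, 'm) monoid_scheme \<Rightarrow> 'x topology \<Rightarrow> ('t \<Rightarrow> 'x \<Rightarrow> 'x) \<Rightarrow> ('x \<Rightarrow> 'x) set" where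
  "enveloping_semigroup T X \<pi> =
     product_topology (\<lambda>_. X) (topspace X) closure_of
       ((\<lambda>t. restrict (\<pi> t) (topspace X)) ` carrier T)"

definition enveloping_topology ::
  "('t, 'm) monoid_scheme \<Rightarrow> 'x topology \<Rightarrow> ('t \<Rightarrow> 'x \<Rightarrow> 'x) \<Rightarrow> ('x \<Rightarrow> 'x) topology" where
  "enveloping_topology T X \<pi> =
     subtopology (product_topology (\<lambda>_. X) (topspace X)) (enveloping_semigroup T X \<pi>)"

definition enveloping_action ::
  "'x topology \<Rightarrow> ('t \<Rightarrow> 'x \<Rightarrow> 'x) \<Rightarrow> 't \<Rightarrow> ('x \<Rightarrow> 'x) \<Rightarrow> ('x \<Rightarrow> 'x)" where
  "enveloping_action X \<pi> t p = compose (topspace X) (\<pi> t) p"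

definition isomorphic_flows ::
  "('t, 'm) monoid_scheme \<Rightarrow> 't topology \<Rightarrow> 'y topology \<Rightarrow> ('t \<Rightarrow> 'y \<Rightarrow> 'y)
    \<Rightarrow> 'z topology \<Rightarrow> ('t \<Rightarrow> 'z \<Rightarrow> 'z) \<Rightarrow> bool" where
  "isomorphic_flows T \<tau> Y \<alpha> Z \<beta> \<longleftrightarrow>
     flow T \<tau> Y \<alpha> \<and> flow T \<tau> Z \<beta> \<and>
     (\<exists>\<phi>. continuous_map Y Z \<phi> \<and> bij_betw \<phi> (topspace Y) (topspace Z) \<and>
        (\<forall>t\<in>carrier T. \<forall>y\<in>topspace Y. \<phi> (\<alpha> t y) = \<beta> t (\<phi> y)))"

end

theory Submission
  imports Defs
begin

text \<open>
  Right multiplication \<open>p \<mapsto> p \<circ> q\<close> and left multiplication by \<open>\<pi> t\<close> are continuous for pointwise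
  convergence, so \<open>E(X)\<close> is a semigroup on which \<open>T\<close> acts. Hence \<open>\<phi> p = (q \<mapsto> p \<circ> q)\<close> is a
  continuous equivariant map \<open>E(X) \<rightarrow> E(X)\<^bsup>E(X)\<^esup>\<close> that sends the translation by \<open>t\<close> on \<open>X\<close> to the
  translation by \<open>t\<close> on \<open>E(X)\<close>. It is injective because \<open>E(X)\<close> contains the identity, and its
  image is \<open>E(E(X))\<close>, being compact, hence closed, and containing the translation_image as a dense subset.
\<close>

context flow
begin

abbreviation "self_maps \<equiv> product_topology (\<lambda>_. X) (topspace X)"
abbreviation "E \<equiv> enveloping_semigroup T X \<pi>"
abbreviation "E_top \<equiv> enveloping_topology T X \<pi>"
abbreviation "E_act \<equiv> enveloping_action X \<pi>"
abbreviation "translation t \<equiv> restrict (\<pi> t) (topspace X)"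

lemma action_closed: "\<lbrakk>t \<in> carrier T; x \<in> topspace X\<rbrakk> \<Longrightarrow> \<pi> t x \<in> topspace X"
  using homeomorphic_imp_continuous_map[OF homeomorphic_action]
  by (auto simp: continuous_map_def)

text \<open>By \<open>action_mult\<close> the map \<open>\<pi> \<one>\<close> is idempotent, and an
  injective idempotent map is the identity.\<close>

lemma action_one: "x \<in> topspace X \<Longrightarrow> \<pi> \<one> x = x"
proof -
  assume x: "x \<in> topspace X"
  have "\<pi> \<one> (\<pi> \<one> x) = \<pi> \<one> x"
    using action_mult[of \<one> \<one> x] x by simp
  with homeomorphic_imp_injective_map[OF homeomorphic_action, of \<one>] x
  show ?thesis
    by (simp add: inj_on_def action_closed)
qed

lemma translation_in_self_maps: "t \<in> carrier T \<Longrightarrow> translation t \<in> topspace self_maps"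
  by (auto simp: action_closed)

lemma enveloping_semigroup_subset: "E \<subseteq> topspace self_maps"
  unfolding enveloping_semigroup_def by (rule closure_of_subset_topspace)

lemma enveloping_semigroup_apply:
  "\<lbrakk>p \<in> E; x \<in> topspace X\<rbrakk> \<Longrightarrow> p x \<in> topspace X"
  using enveloping_semigroup_subset by (auto simp: PiE_iff)

lemma enveloping_semigroup_extensional: "p \<in> E \<Longrightarrow> p \<in> extensional (topspace X)"
  using enveloping_semigroup_subset by (auto simp: PiE_iff)

lemma closedin_enveloping_semigroup: "closedin self_maps E"
  unfolding enveloping_semigroup_def by simp

lemma topspace_enveloping: "topspace E_top = E"
  unfolding enveloping_topology_def using enveloping_semigroup_subset
  by (rule topspace_subtopology_subset)

lemma translation_in_enveloping: "t \<in> carrier T \<Longrightarrow> translation t \<in> E"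
  unfolding enveloping_semigroup_def
  using closure_of_subset[of "translation ` carrier T" self_maps] translation_in_self_maps
  by blast

lemma compact_space_enveloping: "compact_space E_top"
  unfolding enveloping_topology_def
  using compact closedin_enveloping_semigroup
  by (intro compact_space_subtopology closedin_compact_space)
     (auto simp: compact_space_product_topology)

lemma Hausdorff_space_enveloping: "Hausdorff_space E_top"
  unfolding enveloping_topology_def
  by (intro Hausdorff_space_subtopology) (simp add: Hausdorff_space_product_topology Hausdorff)

lemma continuous_map_into_self_maps:
  "continuous_map Y self_maps f \<longleftrightarrow>
     f \<in> topspace Y \<rightarrow> extensional (topspace X) \<and>
     (\<forall>x\<in>topspace X. continuous_map Y X (\<lambda>y. f y x))"
  by (auto simp: continuous_map_componentwise)

lemma continuous_map_into_enveloping: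
  "continuous_map Y E_top f \<longleftrightarrow>
     f \<in> topspace Y \<rightarrow> E \<and> (\<forall>x\<in>topspace X. continuous_map Y X (\<lambda>y. f y x))"
  unfolding enveloping_topology_def continuous_map_in_subtopology continuous_map_into_self_maps
  using enveloping_semigroup_extensional by fastforce

text \<open>Continuity carries the closure of the translations into the closure of their images,
  which stays in the closed set \<open>E\<close>. Invariance of \<open>E\<close> thus only has to be
  checked on translations.\<close>

lemma enveloping_semigroup_image_subset:
  assumes "continuous_map self_maps self_maps f"
    and "\<And>t. t \<in> carrier T \<Longrightarrow> f (translation t) \<in> E"
  shows "f ` E \<subseteq> E"
proof -
  have "f ` E \<subseteq> self_maps closure_of (f ` translation ` carrier T)"
    unfolding enveloping_semigroup_def
    by (rule continuous_map_image_closure_subset[OF assms(1)])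
  also have "\<dots> \<subseteq> E"
    by (rule closure_of_minimal) (use assms(2) closedin_enveloping_semigroup in auto)
  finally show ?thesis .
qed

lemma continuous_map_apply_enveloping:
  "x \<in> topspace X \<Longrightarrow> continuous_map E_top X (\<lambda>p. p x)"
  unfolding enveloping_topology_def
  by (intro continuous_map_from_subtopology continuous_map_product_projection)

lemma enveloping_action_apply: "x \<in> topspace X \<Longrightarrow> E_act t p x = \<pi> t (p x)"
  by (simp add: enveloping_action_def compose_def)

lemma enveloping_action_translation:
  "\<lbrakk>s \<in> carrier T; t \<in> carrier T\<rbrakk> \<Longrightarrow> E_act s (translation t) = translation (s \<otimes> t)"
  by (auto simp: enveloping_action_def compose_def action_mult)

lemma enveloping_action_closed:
  assumes t: "t \<in> carrier T" and "p \<in> E"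
  shows "E_act t p \<in> E"
proof -
  \<comment> \<open>Coordinate \<open>x\<close> of \<open>E_act t p\<close> is evaluation of
    \<open>p\<close> at \<open>x\<close> followed by the homeomorphism
    \<open>\<pi> t\<close>.\<close>
  have "continuous_map self_maps X (\<lambda>p. \<pi> t (p x))" if "x \<in> topspace X" for x
    using continuous_map_compose[OF continuous_map_product_projection[OF that]
        homeomorphic_imp_continuous_map[OF homeomorphic_action[OF t]]]
    by (simp add: o_def)
  then have "continuous_map self_maps self_maps (E_act t)"
    unfolding continuous_map_into_self_maps
    by (auto simp: enveloping_action_apply) (simp add: enveloping_action_def)
  then have "E_act t ` E \<subseteq> E"
    by (rule enveloping_semigroup_image_subset)
       (simp add: enveloping_action_translation t translation_in_enveloping)
  with \<open>p \<in> E\<close> show ?thesis by blast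
qed

text \<open>Here \<open>q\<close> is fixed and \<open>p\<close> varies: coordinate \<open>x\<close>
  of the composite is coordinate \<open>q x\<close> of \<open>p\<close>, hence continuous in
  \<open>p\<close> even if \<open>q\<close> is discontinuous. On translations the composite is
  \<open>E_act t q\<close>, already known to lie in \<open>E\<close>.\<close>

lemma compose_in_enveloping:
  assumes "p \<in> E" and q: "q \<in> E"
  shows "compose (topspace X) p q \<in> E"
proof -
  have "continuous_map self_maps X (\<lambda>p. p (q x))" if "x \<in> topspace X" for x
    by (rule continuous_map_product_projection[OF enveloping_semigroup_apply[OF q that]])
  then have "continuous_map self_maps self_maps (\<lambda>p. compose (topspace X) p q)"
    unfolding continuous_map_into_self_maps by (auto simp: compose_eq)
  moreover have "compose (topspace X) (translation t) q \<in> E" if "t \<in> carrier T" for t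
  proof -
    have "compose (topspace X) (translation t) q = E_act t q"
      by (auto simp: enveloping_action_def compose_def enveloping_semigroup_apply[OF q])
    with enveloping_action_closed[OF that q] show ?thesis by simp
  qed
  ultimately have "(\<lambda>p. compose (topspace X) p q) ` E \<subseteq> E"
    by (rule enveloping_semigroup_image_subset)
  with \<open>p \<in> E\<close> show ?thesis by blast
qed

lemma enveloping_action_mult:
  "\<lbrakk>s \<in> carrier T; t \<in> carrier T; p \<in> E\<rbrakk> \<Longrightarrow> E_act (s \<otimes> t) p = E_act s (E_act t p)"
  by (auto simp: enveloping_action_def compose_def action_mult enveloping_semigroup_apply)

lemma enveloping_action_one: "p \<in> E \<Longrightarrow> E_act \<one> p = p"
  by (rule extensionalityI[of _ "topspace X"])
     (auto simp: enveloping_action_def compose_eq action_one enveloping_semigroup_apply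
        enveloping_semigroup_extensional)

lemma continuous_enveloping_action:
  "continuous_map (prod_topology \<tau> E_top) E_top (\<lambda>(t, p). E_act t p)"
  unfolding continuous_map_into_enveloping
proof (intro conjI ballI)
  show "(\<lambda>(t, p). E_act t p) \<in> topspace (prod_topology \<tau> E_top) \<rightarrow> E"
    by (auto simp: topspace_enveloping topspace_eq enveloping_action_closed)
next
  fix x assume x: "x \<in> topspace X"
  \<comment> \<open>Joint continuity is inherited from \<open>X\<close>: coordinate \<open>x\<close>
    of the action factors through the pair \<open>(t, p x)\<close>.\<close>
  have "continuous_map (prod_topology \<tau> E_top) (prod_topology \<tau> X) (\<lambda>(t, p). (t, p x))"
    using continuous_map_compose[OF continuous_map_snd continuous_map_apply_enveloping[OF x]]
    by (simp add: continuous_map_pairwise o_def case_prod_unfold continuous_map_fst)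
  from continuous_map_compose[OF this continuous_action]
  show "continuous_map (prod_topology \<tau> E_top) X (\<lambda>y. (case y of (t, p) \<Rightarrow> E_act t p) x)"
    by (simp add: o_def case_prod_unfold enveloping_action_apply[OF x])
qed

lemma continuous_enveloping_action_at:
  assumes "t \<in> carrier T"
  shows "continuous_map E_top E_top (E_act t)"
proof -
  have "continuous_map E_top (prod_topology \<tau> E_top) (\<lambda>p. (t, p))"
    using assms by (simp add: continuous_map_pairwise o_def topspace_eq)
  from continuous_map_compose[OF this continuous_enveloping_action]
  show ?thesis by (simp add: o_def)
qed

lemma enveloping_flow: "flow T \<tau> E_top E_act"
proof unfold_locales
  show "compact_space E_top" "Hausdorff_space E_top"
    by (fact compact_space_enveloping Hausdorff_space_enveloping)+
  show "continuous_map (prod_topology \<tau> E_top) E_top (\<lambda>(t, p). E_act t p)"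
    by (fact continuous_enveloping_action)
  show "E_act (s \<otimes> t) p = E_act s (E_act t p)"
    if "s \<in> carrier T" "t \<in> carrier T" "p \<in> topspace E_top" for s t p
    using that by (simp add: topspace_enveloping enveloping_action_mult)
  show "homeomorphic_map E_top E_top (E_act t)" if t: "t \<in> carrier T" for t
  proof (rule homeomorphic_maps_imp_map)
    \<comment> \<open>The two composites are the action of \<open>\<one>\<close>, which fixes
      \<open>E\<close> pointwise.\<close>
    show "homeomorphic_maps E_top E_top (E_act t) (E_act (inv t))"
      unfolding homeomorphic_maps_def
      using t by (simp add: continuous_enveloping_action_at topspace_enveloping
          enveloping_action_mult[symmetric] enveloping_action_one)
  qed
qed

text \<open>The restriction to \<open>E\<close> makes each value extensional, as the points of the
  product of copies of \<open>E_top\<close> indexed by \<open>E\<close> must be.\<close>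

definition left_mult :: "('x \<Rightarrow> 'x) \<Rightarrow> ('x \<Rightarrow> 'x) \<Rightarrow> 'x \<Rightarrow> 'x" where
  "left_mult p = (\<lambda>q\<in>E. compose (topspace X) p q)"

lemma left_mult_translation:
  "t \<in> carrier T \<Longrightarrow> left_mult (translation t) = restrict (E_act t) E"
  by (auto simp: left_mult_def enveloping_action_def compose_def enveloping_semigroup_apply
      intro!: restrict_ext)

text \<open>This is associativity of composition; each \<open>q\<close> in \<open>E\<close> maps
  \<open>topspace X\<close> into itself, so the extensional composites agree.\<close>

lemma left_mult_equivariant:
  "left_mult (E_act t p) = enveloping_action E_top E_act t (left_mult p)"
  by (auto simp: left_mult_def enveloping_action_def topspace_enveloping compose_def
      enveloping_semigroup_apply intro!: restrict_ext)

lemma inj_on_left_mult: "inj_on left_mult E"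
proof (rule inj_on_inverseI)
  fix p assume p: "p \<in> E"
  \<comment> \<open>Evaluation at the identity map of \<open>X\<close>, a member of
    \<open>E\<close>, is a left inverse.\<close>
  show "left_mult p (translation \<one>) = p"
    using p translation_in_enveloping[OF one_closed]
    by (auto simp: left_mult_def compose_eq action_one enveloping_semigroup_extensional
        intro!: extensionalityI[of _ "topspace X"])
qed

lemma continuous_map_left_mult:
  "continuous_map E_top (product_topology (\<lambda>_. E_top) (topspace E_top)) left_mult"
proof -
  \<comment> \<open>There are two layers of coordinates: coordinate \<open>q\<close>, then
    coordinate \<open>x\<close>, of \<open>left_mult p\<close> is \<open>p (q x)\<close>, an
    evaluation of \<open>p\<close> at a point of \<open>X\<close>.\<close>
  have "continuous_map E_top E_top (\<lambda>p. left_mult p q)" if q: "q \<in> E" for q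
    unfolding continuous_map_into_enveloping
    using q by (auto simp: left_mult_def topspace_enveloping compose_in_enveloping compose_eq
        continuous_map_apply_enveloping enveloping_semigroup_apply)
  then show ?thesis
    by (auto simp: continuous_map_componentwise topspace_enveloping left_mult_def)
qed

lemma left_mult_image: "left_mult ` E = enveloping_semigroup T E_top E_act"
proof -
  let ?P = "product_topology (\<lambda>_. E_top) (topspace E_top)"
  have translation_image: "left_mult ` translation ` carrier T =
      (\<lambda>t. restrict (E_act t) (topspace E_top)) ` carrier T"
    by (simp add: image_image left_mult_translation topspace_enveloping)
  \<comment> \<open>The translations are dense in \<open>E\<close> for its own topology, so
    continuity of \<open>left_mult\<close> puts the whole image in the closure of the translations
    of \<open>E\<close>.\<close>
  have "E_top closure_of (translation ` carrier T) = E"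
    unfolding enveloping_topology_def
    by (subst closure_of_subtopology_open)
       (use translation_in_enveloping in \<open>auto simp: enveloping_semigroup_def\<close>)
  then have "left_mult ` E \<subseteq> enveloping_semigroup T E_top E_act"
    using continuous_map_image_closure_subset[OF continuous_map_left_mult,
        of "translation ` carrier T"] translation_image
    by (simp add: enveloping_semigroup_def)
  \<comment> \<open>For the converse inclusion, the image is compact in a Hausdorff space, hence a
    closed set containing all translations of \<open>E\<close>.\<close>
  moreover have "closedin ?P (left_mult ` E)"
  proof (rule compactin_imp_closedin)
    show "Hausdorff_space ?P"
      by (simp add: Hausdorff_space_product_topology Hausdorff_space_enveloping)
    show "compactin ?P (left_mult ` E)"
      using image_compactin[OF _ continuous_map_left_mult] compact_space_enveloping
      by (simp add: compact_space_def topspace_enveloping)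
  qed
  then have "enveloping_semigroup T E_top E_act \<subseteq> left_mult ` E"
    unfolding enveloping_semigroup_def[of T E_top] translation_image[symmetric]
    by (intro closure_of_minimal image_mono) (auto simp: translation_in_enveloping)
  ultimately show ?thesis by blast
qed

end

theorem theorem5:
  fixes T :: "('t, 'm) monoid_scheme" and \<tau> :: "'t topology"
    and X :: "'x topology" and \<pi> :: "'t \<Rightarrow> 'x \<Rightarrow> 'x"
  assumes "flow T \<tau> X \<pi>"
    and "\<forall>x\<in>topspace X. \<not> openin X {x}"
  shows "isomorphic_flows T \<tau>
    (enveloping_topology T X \<pi>) (enveloping_action X \<pi>)
    (enveloping_topology T (enveloping_topology T X \<pi>) (enveloping_action X \<pi>))
    (enveloping_action (enveloping_topology T X \<pi>) (enveloping_action X \<pi>))"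
proof -
  interpret flow T \<tau> X \<pi> by fact
  \<comment> \<open>The flow on \<open>E(X)\<close> is a model of the same locale, so
    \<open>E.E_top\<close> and \<open>E.E_act\<close> are the space and action of
    \<open>E(E(X))\<close>, and \<open>E.enveloping_flow\<close> makes them a flow.\<close>
  interpret E: flow T \<tau> E_top E_act by (fact enveloping_flow)
  \<comment> \<open>The codomain shrinks from the full product to the subspace that
    \<open>left_mult_image\<close> identifies as the image.\<close>
  have "continuous_map E_top E.E_top left_mult"
    using continuous_map_left_mult left_mult_image
    by (auto simp: enveloping_topology_def[of T E_top] continuous_map_in_subtopology
        topspace_enveloping)
  moreover have "bij_betw left_mult (topspace E_top) (topspace E.E_top)"
    by (simp add: bij_betw_def inj_on_left_mult topspace_enveloping E.topspace_enveloping
        left_mult_image)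
  moreover have "\<forall>t\<in>carrier T. \<forall>p\<in>topspace E_top. left_mult (E_act t p) = E.E_act t (left_mult p)"
    by (simp add: topspace_enveloping left_mult_equivariant)
  ultimately show ?thesis
    unfolding isomorphic_flows_def using enveloping_flow E.enveloping_flow by blast
qed

end
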